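(* Let $G$ be a finite solvable group. Then the following statements are equivalent: (a) $G$ is a WSM-group; (b) every non-Frattini chief factor of $G$, regarded as a $G$-module (via conjugation), is strongly irreducible.
   Context: All groups are finite. A maximal subgroup of a group is a proper subgroup not properly contained in any other proper subgroup. For a proper subgroup $H$ of $G$, $\mathrm{Max}(G,H)$ denotes the set of all maximal subgroups of $G$ containing $H$. A proper subgroup $H$ of $G$ is a second maximal subgroup of $G$ if $H$ is a maximal subgroup of every member of $\mathrm{Max}(G,H)$; it is a weak second maximal subgroup of $G$ if $H$ is a maximal subgroup of some member of $\mathrm{Max}(G,H)$. A group $G$ is a WSM-group if every weak second maximal subgroup of $G$ is a second maximal subgroup of $G$. A chief factor of $G$ is a quotient $H/K$ where $K<H$ are normal subgroups of $G$ and $H/K$ is a minimal normal subgroup of $G/K$. It is called non-Frattini if $H/K\not\leq\Phi(G/K)$, where $\Phi$ denotes the Frattini subgroup. When $G$ is solvable, a chief factor $H/K$ is an elementary abelian $p$-group for some prime $p$, and is a $G$-module over $\mathbb{F}_p$ with $G$ acting by conjugation; it is irreducible under a subgroup $M\leq G$ if its only $M$-invariant subgroups are the trivial subgroup and itself. An irreducible $G$-module $V$ is called strongly irreducible if $G=1$ or $V$ (restricted to $M$) is an irreducible $M$-module for every maximal subgroup $M$ of $G$. *)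

theory Defs
  imports "HOL-Algebra.Bij" "HOL-Algebra.Coset" "HOL-Algebra.Solvable_Groups"
begin

section \<open>Maximal and second maximal subgroups\<close>

definition proper_subgroup :: "'a set \<Rightarrow> ('a, 'b) monoid_scheme \<Rightarrow> bool"
  where "proper_subgroup H G \<longleftrightarrow> subgroup H G \<and> H \<noteq> carrier G"

definition maximal_subgroup :: "'a set \<Rightarrow> ('a, 'b) monoid_scheme \<Rightarrow> bool"
  where "maximal_subgroup M G \<longleftrightarrow>
    proper_subgroup M G \<and> \<not> (\<exists>L. proper_subgroup L G \<and> M \<subset> L)"

definition Max_over :: "('a, 'b) monoid_scheme \<Rightarrow> 'a set \<Rightarrow> 'a set set"
  where "Max_over G H = {M. maximal_subgroup M G \<and> H \<subseteq> M}"

definition second_maximal :: "'a set \<Rightarrow> ('a, 'b) monoid_scheme \<Rightarrow> bool"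
  where "second_maximal H G \<longleftrightarrow>
    proper_subgroup H G \<and> (\<forall>M \<in> Max_over G H. maximal_subgroup H (G\<lparr>carrier := M\<rparr>))"

definition weak_second_maximal :: "'a set \<Rightarrow> ('a, 'b) monoid_scheme \<Rightarrow> bool"
  where "weak_second_maximal H G \<longleftrightarrow>
    proper_subgroup H G \<and> (\<exists>M \<in> Max_over G H. maximal_subgroup H (G\<lparr>carrier := M\<rparr>))"

definition WSM_group :: "('a, 'b) monoid_scheme \<Rightarrow> bool"
  where "WSM_group G \<longleftrightarrow> group G \<and> (\<forall>H. weak_second_maximal H G \<longrightarrow> second_maximal H G)"


section \<open>Chief factors\<close>

text \<open>Intersecting with the carrier makes the trivial group, which has no maximal subgroups,
  its own Frattini subgroup.\<close>

definition frattini :: "('a, 'b) monoid_scheme \<Rightarrow> 'a set"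
  where "frattini G = carrier G \<inter> \<Inter> {M. maximal_subgroup M G}"

definition minimal_normal :: "'a set \<Rightarrow> ('a, 'b) monoid_scheme \<Rightarrow> bool"
  where "minimal_normal N G \<longleftrightarrow>
    N \<lhd> G \<and> N \<noteq> {\<one>\<^bsub>G\<^esub>} \<and> (\<forall>L. L \<lhd> G \<and> L \<subseteq> N \<longrightarrow> L = {\<one>\<^bsub>G\<^esub>} \<or> L = N)"

text \<open>The quotient of \<open>H\<close> by \<open>K\<close> as a group in its own right. Its elements are cosets
  \<open>K #> h\<close> with \<open>h \<in> H\<close>, so its carrier is literally a subset of the carrier of
  \<open>G Mod K\<close>.\<close>

definition factor :: "('a, 'b) monoid_scheme \<Rightarrow> 'a set \<Rightarrow> 'a set \<Rightarrow> 'a set monoid"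
  where "factor G H K = (G\<lparr>carrier := H\<rparr>) Mod K"

definition chief_factor :: "('a, 'b) monoid_scheme \<Rightarrow> 'a set \<Rightarrow> 'a set \<Rightarrow> bool"
  where "chief_factor G H K \<longleftrightarrow>
    H \<lhd> G \<and> K \<lhd> G \<and> K \<subset> H \<and> minimal_normal (carrier (factor G H K)) (G Mod K)"

definition non_frattini_chief_factor :: "('a, 'b) monoid_scheme \<Rightarrow> 'a set \<Rightarrow> 'a set \<Rightarrow> bool"
  where "non_frattini_chief_factor G H K \<longleftrightarrow>
    chief_factor G H K \<and> \<not> carrier (factor G H K) \<subseteq> frattini (G Mod K)"


section \<open>Modules\<close>

text \<open>A module for \<open>G\<close> is an abelian group, written multiplicatively, on which \<open>G\<close> acts by
  automorphisms. If the group is elementary abelian of exponent \<open>p\<close>, then the scalars from the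
  field with \<open>p\<close> elements act by powers, so every subgroup is a subspace and the submodules
  over that field are exactly the invariant subgroups.\<close>

locale gmodule = G: group G + V: comm_group V
  for G :: "('a, 'b) monoid_scheme" and V :: "('v, 'c) monoid_scheme" +
  fixes \<phi> :: "'a \<Rightarrow> 'v \<Rightarrow> 'v"
  assumes action_hom: "\<phi> \<in> hom G (AutoGroup V)"

definition submodule ::
    "'v set \<Rightarrow> ('a, 'b) monoid_scheme \<Rightarrow> ('v, 'c) monoid_scheme \<Rightarrow> ('a \<Rightarrow> 'v \<Rightarrow> 'v) \<Rightarrow> bool"
  where "submodule W G V \<phi> \<longleftrightarrow> subgroup W V \<and> (\<forall>g \<in> carrier G. \<phi> g ` W \<subseteq> W)"

definition irreducible_gmodule ::
    "('a, 'b) monoid_scheme \<Rightarrow> ('v, 'c) monoid_scheme \<Rightarrow> ('a \<Rightarrow> 'v \<Rightarrow> 'v) \<Rightarrow> bool"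
  where "irreducible_gmodule G V \<phi> \<longleftrightarrow>
    gmodule G V \<phi> \<and> carrier V \<noteq> {\<one>\<^bsub>V\<^esub>} \<and>
    (\<forall>W. submodule W G V \<phi> \<longrightarrow> W = {\<one>\<^bsub>V\<^esub>} \<or> W = carrier V)"

definition strongly_irreducible ::
    "('a, 'b) monoid_scheme \<Rightarrow> ('v, 'c) monoid_scheme \<Rightarrow> ('a \<Rightarrow> 'v \<Rightarrow> 'v) \<Rightarrow> bool"
  where "strongly_irreducible G V \<phi> \<longleftrightarrow>
    irreducible_gmodule G V \<phi> \<and>
    (carrier G = {\<one>\<^bsub>G\<^esub>} \<or>
     (\<forall>M. maximal_subgroup M G \<longrightarrow> irreducible_gmodule (G\<lparr>carrier := M\<rparr>) V \<phi>))"

text \<open>Elements of \<open>AutoGroup\<close> are extensional functions, hence the restriction to the carrier.\<close>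

definition conj_action ::
    "('a, 'b) monoid_scheme \<Rightarrow> 'a set \<Rightarrow> 'a set \<Rightarrow> 'a \<Rightarrow> 'a set \<Rightarrow> 'a set"
  where "conj_action G H K g =
    (\<lambda>X \<in> carrier (factor G H K). g <#\<^bsub>G\<^esub> X #>\<^bsub>G\<^esub> inv\<^bsub>G\<^esub> g)"

lemma carrier_factor: "carrier (factor G H K) = (\<lambda>h. K #>\<^bsub>G\<^esub> h) ` H"
  by (auto simp: factor_def carrier_FactGroup r_coset_def)

lemma mult_factor: "X \<otimes>\<^bsub>factor G H K\<^esub> Y = X <#>\<^bsub>G\<^esub> Y"
  by (simp add: factor_def set_mult_def)

lemma (in group) conj_action_rcos:
  assumes "H \<lhd> G" "K \<lhd> G" "g \<in> carrier G" "h \<in> H"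
  shows "conj_action G H K g (K #> h) = K #> (g \<otimes> h \<otimes> inv g)"
proof -
  interpret H: normal H G by fact
  interpret K: normal K G by fact
  have h: "h \<in> carrier G" using assms(4) by (rule H.mem_carrier)
  have "g <# (K #> h) #> inv g = (g <# K) #> h #> inv g"
    by (simp add: lcos_m_assoc rcos_assoc_lcos K.subset h assms(3) coset_assoc)
  also have "g <# K = K #> g" using K.coset_eq assms(3) by simp
  also have "K #> g #> h #> inv g = K #> (g \<otimes> h \<otimes> inv g)"
    using K.subset h assms(3) by (simp add: coset_mult_assoc m_assoc)
  finally show ?thesis using assms(4) by (simp add: conj_action_def carrier_factor)
qed

text \<open>Conjugation makes every abelian factor a module. In a solvable group every chief factor is
  abelian, so requiring a module in \<^term>\<open>irreducible_gmodule\<close> excludes none of them.\<close>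

lemma (in group) gmodule_conj_action:
  assumes "H \<lhd> G" "K \<lhd> G" "comm_group (factor G H K)"
  shows "gmodule G (factor G H K) (conj_action G H K)"
proof -
  interpret H: normal H G by fact
  interpret K: normal K G by fact
  interpret V: comm_group "factor G H K" by fact
  let ?V = "carrier (factor G H K)"
  let ?c = "conj_action G H K"
  have cl: "g \<otimes> h \<otimes> inv g \<in> H" if "g \<in> carrier G" "h \<in> H" for g h
    using H.inv_op_closed2 that by blast
  have maps: "?c g \<in> ?V \<rightarrow> ?V" if "g \<in> carrier G" for g
    using that cl by (auto simp: carrier_factor conj_action_rcos assms)
  have comp: "?c a (?c b X) = ?c (a \<otimes> b) X"
    if "a \<in> carrier G" "b \<in> carrier G" "X \<in> ?V" for a b X
  proof -
    obtain h where h: "h \<in> H" "X = K #> h" using \<open>X \<in> ?V\<close> by (auto simp: carrier_factor)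
    show ?thesis
      using that h cl by (simp add: conj_action_rcos assms m_assoc inv_mult_group)
  qed
  have one: "?c \<one> X = X" if "X \<in> ?V" for X
    using that by (auto simp: carrier_factor conj_action_rcos assms)
  have hom: "?c g \<in> hom (factor G H K) (factor G H K)" if g: "g \<in> carrier G" for g
  proof (rule homI)
    show "?c g X \<in> ?V" if "X \<in> ?V" for X using maps[OF g] that by auto
    fix X Y assume "X \<in> ?V" "Y \<in> ?V"
    then obtain x y where xy: "x \<in> H" "y \<in> H" "X = K #> x" "Y = K #> y"
      by (auto simp: carrier_factor)
    have "g \<otimes> (x \<otimes> y) \<otimes> inv g = (g \<otimes> x \<otimes> inv g) \<otimes> (g \<otimes> y \<otimes> inv g)"
      using g xy by (simp add: m_assoc inv_solve_left)
    then show "?c g (X \<otimes>\<^bsub>factor G H K\<^esub> Y) = ?c g X \<otimes>\<^bsub>factor G H K\<^esub> ?c g Y"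
      using g xy cl by (simp add: mult_factor K.rcos_sum conj_action_rcos assms)
  qed
  have bij: "?c g \<in> Bij ?V" if g: "g \<in> carrier G" for g
  proof -
    have "bij_betw (?c g) ?V ?V"
      by (rule bij_betw_byWitness[where f' = "?c (inv g)"]) (use g maps in \<open>auto simp: comp one\<close>)
    then show ?thesis by (simp add: Bij_def conj_action_def)
  qed
  have "?c \<in> hom G (AutoGroup (factor G H K))"
  proof (rule homI)
    show "?c g \<in> carrier (AutoGroup (factor G H K))" if "g \<in> carrier G" for g
      using that hom bij by (simp add: AutoGroup_def auto_def)
    fix a b assume ab: "a \<in> carrier G" "b \<in> carrier G"
    have "?c (a \<otimes> b) = compose ?V (?c a) (?c b)"
    proof
      show "?c (a \<otimes> b) X = compose ?V (?c a) (?c b) X" for X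
        using ab by (cases "X \<in> ?V") (simp_all add: compose_def comp, simp add: conj_action_def)
    qed
    then show "?c (a \<otimes> b) = ?c a \<otimes>\<^bsub>AutoGroup (factor G H K)\<^esub> ?c b"
      using ab bij by (simp add: AutoGroup_def BijGroup_def)
  qed
  then show ?thesis
    by (intro gmodule.intro gmodule_axioms.intro is_group V.comm_group_axioms)
qed

end

theory Submission
  imports Defs "HOL-Algebra.Zassenhaus"
begin

text \<open>A chief factor \<open>H / K\<close> of a finite solvable group is abelian, and its submodules under a
  subgroup \<open>L\<close> are the \<open>L\<close>-invariant subgroups between \<open>K\<close> and \<open>H\<close>. It is non-Frattini exactly when
  some maximal subgroup \<open>M\<close> contains \<open>K\<close> but not \<open>H\<close>, and then \<open>M\<close> is a complement: \<open>H M = G\<close>, and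
  \<open>H \<inter> M\<close> is normal (\<open>Int_maximal_normal\<close>), so it equals \<open>K\<close>. Both implications are then
  computations with the modular law in the subgroup lattice.

  Suppose \<open>G\<close> is a WSM-group, and let \<open>L\<close> be maximal. If \<open>L\<close> does not contain \<open>H\<close>, then \<open>G = H L\<close>
  and \<open>H\<close> acts trivially on \<open>H / K\<close>, so \<open>L\<close> and \<open>G\<close> have the same submodules. If it does, then
  \<open>L \<inter> M\<close> is maximal in \<open>M\<close>, hence in \<open>L\<close>, and an \<open>L\<close>-invariant \<open>W\<close> between \<open>K\<close> and \<open>H\<close> gives the
  subgroup \<open>W (L \<inter> M)\<close> between \<open>L \<inter> M\<close> and \<open>L\<close>, which forces \<open>W = K\<close> or \<open>W = H\<close>
  (\<open>WSM_imp_irreducible_section\<close>).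

  Conversely, let \<open>X\<close> be maximal in a maximal subgroup \<open>M\<close> and contained in another maximal
  subgroup \<open>L\<close>, so that \<open>X = M \<inter> L\<close>. A normal subgroup \<open>D\<close> of smallest order not contained in
  \<open>M\<close> gives the non-Frattini chief factor \<open>D / (D \<inter> M)\<close>, and its irreducibility under \<open>L\<close> carries
  maximality of \<open>M \<inter> L\<close> in \<open>M\<close> over to \<open>L\<close> (\<open>maximal_Int_transfer\<close>). Choosing \<open>D\<close> in this way
  avoids the core of \<open>M\<close> and any conjugacy theorem for complements.\<close>

section \<open>Products of subgroups and maximal subgroups\<close>

context group
begin

lemma subset_set_mult:
  assumes "subgroup A G" "subgroup B G"
  shows "A \<subseteq> A <#> B" "B \<subseteq> A <#> B"
proof -
  have "x = x \<otimes> \<one>" "x = \<one> \<otimes> x" if "x \<in> A \<or> x \<in> B" for x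
    using that assms by (auto simp: subgroup.mem_carrier)
  then show "A \<subseteq> A <#> B" "B \<subseteq> A <#> B"
    using assms[THEN subgroup.one_closed] unfolding set_mult_def by blast+
qed

lemma set_mult_subset:
  assumes "subgroup L G" "A \<subseteq> L" "B \<subseteq> L"
  shows "A <#> B \<subseteq> L"
  using assms by (auto simp: set_mult_def subgroup.m_closed subset_iff)

lemma dedekind_left:
  assumes A: "subgroup A G" and B: "subgroup B G" and L: "subgroup L G" and "A \<subseteq> L"
  shows "L \<inter> (A <#> B) = A <#> (L \<inter> B)"
proof
  show "A <#> (L \<inter> B) \<subseteq> L \<inter> (A <#> B)"
    using assms by (auto simp: set_mult_def subgroup.m_closed subset_iff)
  show "L \<inter> (A <#> B) \<subseteq> A <#> (L \<inter> B)"
  proof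
    fix x assume "x \<in> L \<inter> (A <#> B)"
    then obtain a b where ab: "a \<in> A" "b \<in> B" "x = a \<otimes> b" "x \<in> L"
      by (auto simp: set_mult_def)
    have "a \<in> carrier G" "b \<in> carrier G"
      using ab A B by (auto simp: subgroup.mem_carrier)
    then have "b = inv a \<otimes> x" using ab by (simp add: m_assoc[symmetric])
    moreover have "inv a \<in> L" using ab \<open>A \<subseteq> L\<close> L by (auto intro: subgroup.m_inv_closed)
    ultimately have "b \<in> L" using subgroup.m_closed[OF L _ ab(4), of "inv a"] by simp
    then show "x \<in> A <#> (L \<inter> B)" using ab by (auto simp: set_mult_def)
  qed
qed

lemma dedekind_right:
  assumes A: "subgroup A G" and B: "subgroup B G" and L: "subgroup L G" and "B \<subseteq> L"
  shows "L \<inter> (A <#> B) = (L \<inter> A) <#> B"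
proof
  show "(L \<inter> A) <#> B \<subseteq> L \<inter> (A <#> B)"
    using assms by (auto simp: set_mult_def subgroup.m_closed subset_iff)
  show "L \<inter> (A <#> B) \<subseteq> (L \<inter> A) <#> B"
  proof
    fix x assume "x \<in> L \<inter> (A <#> B)"
    then obtain a b where ab: "a \<in> A" "b \<in> B" "x = a \<otimes> b" "x \<in> L"
      by (auto simp: set_mult_def)
    have "a \<in> carrier G" "b \<in> carrier G"
      using ab A B by (auto simp: subgroup.mem_carrier)
    then have "a = x \<otimes> inv b" using ab by (simp add: m_assoc)
    moreover have "inv b \<in> L" using ab \<open>B \<subseteq> L\<close> L by (auto intro: subgroup.m_inv_closed)
    ultimately have "a \<in> L" using subgroup.m_closed[OF L ab(4), of "inv b"] by simp
    then show "x \<in> (L \<inter> A) <#> B" using ab by (auto simp: set_mult_def)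
  qed
qed

text \<open>Maximality inside a subgroup, expressed through subgroups of the ambient group.\<close>

lemma maximal_subgroup_in_iff:
  assumes M: "subgroup M G"
  shows "maximal_subgroup X (G\<lparr>carrier := M\<rparr>) \<longleftrightarrow>
    subgroup X G \<and> X \<subset> M \<and> (\<forall>J. subgroup J G \<and> X \<subseteq> J \<and> J \<subseteq> M \<longrightarrow> J = X \<or> J = M)"
proof -
  have [simp]: "subgroup J (G\<lparr>carrier := M\<rparr>) \<longleftrightarrow> subgroup J G \<and> J \<subseteq> M" for J
    using incl_subgroup[OF M] subgroup_incl[OF _ M] subgroup.subset[of J "G\<lparr>carrier := M\<rparr>"]
    by (simp, blast)
  show ?thesis
    by (simp add: maximal_subgroup_def proper_subgroup_def psubset_eq)
      (intro iffI; elim conjE; intro conjI allI impI; metis)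
qed

lemma maximal_subgroup_iff:
  "maximal_subgroup X G \<longleftrightarrow>
    subgroup X G \<and> X \<subset> carrier G \<and>
    (\<forall>J. subgroup J G \<and> X \<subseteq> J \<longrightarrow> J = X \<or> J = carrier G)"
proof -
  have "subgroup J G \<and> X \<subseteq> J \<and> J \<subseteq> carrier G \<longleftrightarrow> subgroup J G \<and> X \<subseteq> J" for J
    using subgroup.subset[of J G] by blast
  then show ?thesis using maximal_subgroup_in_iff[OF subgroup_self, of X] by simp
qed

lemma maximal_subgroup_inD:
  assumes "maximal_subgroup X (G\<lparr>carrier := M\<rparr>)" "subgroup M G"
  shows "subgroup X G" "X \<subset> M"
    "\<And>J. subgroup J G \<Longrightarrow> X \<subseteq> J \<Longrightarrow> J \<subseteq> M \<Longrightarrow> J = X \<or> J = M"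
  using assms(1) unfolding maximal_subgroup_in_iff[OF assms(2)] by simp_all

lemma maximal_subgroupD:
  assumes "maximal_subgroup M G"
  shows "subgroup M G" "M \<subset> carrier G"
    "\<And>J. subgroup J G \<Longrightarrow> M \<subseteq> J \<Longrightarrow> J = M \<or> J = carrier G"
  using assms unfolding maximal_subgroup_iff by simp_all

lemma maximal_subgroup_subset_eq:
  assumes "maximal_subgroup M G" "maximal_subgroup L G" "M \<subseteq> L"
  shows "L = M"
  using maximal_subgroupD(3)[OF assms(1) maximal_subgroupD(1)[OF assms(2)] assms(3)]
    maximal_subgroupD(2)[OF assms(2)] by blast

lemma maximal_subgroup_set_mult:
  assumes "maximal_subgroup M G" "N \<lhd> G" "\<not> N \<subseteq> M"
  shows "N <#> M = carrier G"
proof -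
  have M: "subgroup M G" using assms(1) by (rule maximal_subgroupD)
  have "subgroup (N <#> M) G" using assms(2) M by (rule mult_norm_subgroup)
  moreover have "N \<subseteq> N <#> M" "M \<subseteq> N <#> M"
    using subset_set_mult[OF normal_imp_subgroup[OF assms(2)] M] by auto
  ultimately show ?thesis using maximal_subgroupD(3)[OF assms(1)] assms(3) by metis
qed


section \<open>Abelian normal sections\<close>

text \<open>Every element \<open>h \<in> H\<close> moves \<open>x \<in> H\<close> by a commutator, so a subgroup above the derived
  subgroup of \<open>H\<close> is normalised by \<open>H\<close>.\<close>

lemma conj_mem_of_derived_subset:
  assumes "subgroup S G" "derived G H \<subseteq> S" "H \<subseteq> carrier G" "h \<in> H" "x \<in> H" "x \<in> S"
  shows "h \<otimes> x \<otimes> inv h \<in> S"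
proof -
  have c: "h \<in> carrier G" "x \<in> carrier G" using assms by auto
  have "h \<otimes> x \<otimes> inv h \<otimes> inv x \<in> derived G H"
    unfolding derived_def using assms(4,5) by (intro generate.incl) auto
  then have "(h \<otimes> x \<otimes> inv h \<otimes> inv x) \<otimes> x \<in> S"
    using assms by (auto intro: subgroup.m_closed)
  then show ?thesis using c by (simp add: m_assoc)
qed

lemma conj_set_mult:
  assumes "h \<in> carrier G" "l \<in> carrier G" "x \<in> carrier G"
  shows "(h \<otimes> l) \<otimes> x \<otimes> inv (h \<otimes> l) = h \<otimes> (l \<otimes> x \<otimes> inv l) \<otimes> inv h"
  using assms by (simp add: inv_mult_group m_assoc)

lemma Int_maximal_normal:
  assumes H: "H \<lhd> G" and M: "maximal_subgroup M G" and "\<not> H \<subseteq> M" "derived G H \<subseteq> M"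
  shows "H \<inter> M \<lhd> G"
proof (rule normal_invI)
  interpret H: normal H G by fact
  have sM: "subgroup M G" using M by (rule maximal_subgroupD)
  show "subgroup (H \<inter> M) G" using H.subgroup_axioms sM by (rule subgroups_Inter_pair)
  fix g x assume g: "g \<in> carrier G" and x: "x \<in> H \<inter> M"
  have "g \<in> H <#> M" using maximal_subgroup_set_mult[OF M H \<open>\<not> H \<subseteq> M\<close>] g by simp
  then obtain h m where hm: "h \<in> H" "m \<in> M" "g = h \<otimes> m" by (auto simp: set_mult_def)
  have c: "h \<in> carrier G" "m \<in> carrier G" "x \<in> carrier G"
    using hm x sM by (auto simp: subgroup.mem_carrier)
  let ?y = "m \<otimes> x \<otimes> inv m"
  have y: "?y \<in> H" "?y \<in> M"
    using x hm sM c H.inv_op_closed2 by (auto intro!: subgroup.m_closed subgroup.m_inv_closed)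
  have "h \<otimes> ?y \<otimes> inv h \<in> M"
    using conj_mem_of_derived_subset[OF sM assms(4) H.subset hm(1) y] .
  moreover have "h \<otimes> ?y \<otimes> inv h \<in> H" using y c H.inv_op_closed2 by blast
  ultimately show "g \<otimes> x \<otimes> inv g \<in> H \<inter> M"
    using conj_set_mult[OF c] hm(3) by simp
qed

lemma funpow_derived_fixed:
  assumes "N \<subseteq> derived G N" "N \<subseteq> A"
  shows "N \<subseteq> (derived G ^^ n) A"
proof (induction n)
  case (Suc n)
  then have "derived G N \<subseteq> derived G ((derived G ^^ n) A)" by (rule mono_derived)
  then show ?case using assms(1) by simp
qed (use assms(2) in simp)

text \<open>A normal subgroup of smallest order not contained in \<open>S\<close>. Solvability makes its derived
  subgroup strictly smaller, which therefore lies in \<open>S\<close>.\<close>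

lemma exists_normal_minimal_not_subset:
  assumes fin: "finite (carrier G)" and solv: "solvable G"
    and N: "N \<lhd> G" and S: "subgroup S G" "\<not> N \<subseteq> S"
  obtains D where "D \<lhd> G" "D \<subseteq> N" "\<not> D \<subseteq> S" "derived G D \<subseteq> S"
    "\<forall>R. R \<lhd> G \<and> R \<subset> D \<longrightarrow> R \<subseteq> S"
proof -
  define P where "P D \<longleftrightarrow> D \<lhd> G \<and> D \<subseteq> N \<and> \<not> D \<subseteq> S" for D
  have "P N" using N S by (simp add: P_def)
  then obtain D where D: "P D" and least: "\<And>R. P R \<Longrightarrow> card D \<le> card R"
    using arg_min_nat_lemma[of P N card] by blast
  interpret D: normal D G using D by (simp add: P_def)
  have finD: "finite D" using fin D.subset finite_subset by blast
  have small: "R \<subseteq> S" if "R \<lhd> G" "R \<subset> D" for R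
  proof (rule ccontr)
    assume "\<not> R \<subseteq> S"
    then have "P R" using that D by (auto simp: P_def)
    then show False using least psubset_card_mono[OF finD that(2)] by fastforce
  qed
  have "\<not> D \<subseteq> derived G D"
  proof
    assume sub: "D \<subseteq> derived G D"
    obtain n where "(derived G ^^ n) (carrier G) = {\<one>}"
      using solvable_imp_trivial_derived_seq solv by (auto simp: solvable_def)
    then have "D \<subseteq> {\<one>}" using funpow_derived_fixed[OF sub D.subset, of n] by simp
    then show False using D S(1) by (auto simp: P_def dest: subgroup.one_closed)
  qed
  moreover have "derived G D \<subseteq> D" by (rule derived_incl) (auto simp: D.subgroup_axioms)
  ultimately have "derived G D \<subseteq> S"
    using small[OF derived_is_normal[OF D.normal_axioms]] by blast
  then show thesis using D small by (intro that[of D]) (auto simp: P_def)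
qed

end


section \<open>Irreducibility of a normal section\<close>

text \<open>The section \<open>H / K\<close> has no proper nontrivial subgroup \<open>W / K\<close> invariant under conjugation by
  the elements of \<open>L\<close>. It is allowed to be trivial.\<close>

definition irreducible_section :: "('a, 'b) monoid_scheme \<Rightarrow> 'a set \<Rightarrow> 'a set \<Rightarrow> 'a set \<Rightarrow> bool"
  where "irreducible_section G L H K \<longleftrightarrow>
    (\<forall>W. subgroup W G \<and> K \<subseteq> W \<and> W \<subseteq> H \<and> (\<forall>g \<in> L. \<forall>w \<in> W. g \<otimes>\<^bsub>G\<^esub> w \<otimes>\<^bsub>G\<^esub> inv\<^bsub>G\<^esub> g \<in> W)
      \<longrightarrow> W = K \<or> W = H)"

lemma irreducible_sectionD:
  assumes "irreducible_section G L H K" "subgroup W G" "K \<subseteq> W" "W \<subseteq> H"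
    "\<And>g w. g \<in> L \<Longrightarrow> w \<in> W \<Longrightarrow> g \<otimes>\<^bsub>G\<^esub> w \<otimes>\<^bsub>G\<^esub> inv\<^bsub>G\<^esub> g \<in> W"
  shows "W = K \<or> W = H"
  using assms unfolding irreducible_section_def by blast

context group
begin

lemma irreducible_section_carrier_iff:
  "irreducible_section G (carrier G) H K \<longleftrightarrow>
    (\<forall>R. R \<lhd> G \<and> K \<subseteq> R \<and> R \<subseteq> H \<longrightarrow> R = K \<or> R = H)"
  unfolding irreducible_section_def normal_inv_iff by blast

text \<open>An abelian section \<open>H / K\<close> is centralised by \<open>H\<close>, so only the action modulo \<open>H\<close> matters.\<close>

lemma irreducible_section_supplement:
  assumes irr: "irreducible_section G (carrier G) H K"
    and H: "H \<lhd> G" and der: "derived G H \<subseteq> K"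
    and L: "L \<subseteq> carrier G" "H <#> L = carrier G"
  shows "irreducible_section G L H K"
  unfolding irreducible_section_def
proof (intro allI impI, elim conjE)
  interpret H: normal H G by fact
  fix W assume W: "subgroup W G" "K \<subseteq> W" "W \<subseteq> H"
    and inv: "\<forall>g\<in>L. \<forall>w\<in>W. g \<otimes> w \<otimes> inv g \<in> W"
  have "g \<otimes> w \<otimes> inv g \<in> W" if g: "g \<in> carrier G" and w: "w \<in> W" for g w
  proof -
    have "g \<in> H <#> L" using g L(2) by simp
    then obtain h l where hl: "h \<in> H" "l \<in> L" "g = h \<otimes> l" by (auto simp: set_mult_def)
    have c: "h \<in> carrier G" "l \<in> carrier G" "w \<in> carrier G"
      using hl w W L by (auto simp: subgroup.mem_carrier)
    have y: "l \<otimes> w \<otimes> inv l \<in> W" using inv hl w by blast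
    have "h \<otimes> (l \<otimes> w \<otimes> inv l) \<otimes> inv h \<in> W"
      by (rule conj_mem_of_derived_subset[OF W(1) _ H.subset hl(1) _ y]) (use der W y in auto)
    then show ?thesis using conj_set_mult[OF c] hl(3) by simp
  qed
  then show "W = K \<or> W = H" using irreducible_sectionD[OF irr W] by blast
qed


section \<open>Second maximal subgroups and irreducible sections\<close>

text \<open>A maximal subgroup \<open>L\<close> containing \<open>H\<close> meets the complement \<open>M\<close> of \<open>H\<close> over \<open>K\<close> in a maximal
  subgroup of \<open>M\<close>. If \<open>L \<inter> M\<close> is also maximal in \<open>L\<close>, an \<open>L\<close>-invariant \<open>W\<close> strictly between \<open>K\<close>
  and \<open>H\<close> is impossible, since \<open>W (L \<inter> M)\<close> would lie strictly between \<open>L \<inter> M\<close> and \<open>L\<close>.\<close>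

lemma WSM_imp_irreducible_section:
  assumes wsm: "WSM_group G"
    and H: "H \<lhd> G" and K: "K \<lhd> G" "K \<subseteq> H" and der: "derived G H \<subseteq> K"
    and irr: "irreducible_section G (carrier G) H K"
    and M: "maximal_subgroup M G" "K \<subseteq> M" "\<not> H \<subseteq> M"
    and L: "maximal_subgroup L G"
  shows "irreducible_section G L H K"
proof (cases "H \<subseteq> L")
  case False
  show ?thesis
    by (rule irreducible_section_supplement[OF irr H der
          subgroup.subset[OF maximal_subgroupD(1)[OF L]] maximal_subgroup_set_mult[OF L H False]])
next
  case True
  have sM: "subgroup M G" and sL: "subgroup L G"
    using M(1) L by (auto dest: maximal_subgroupD(1))
  have sH: "subgroup H G" using H by (rule normal_imp_subgroup)
  have HM: "H <#> M = carrier G" using maximal_subgroup_set_mult[OF M(1) H M(3)] .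
  have "H \<inter> M \<lhd> G" using Int_maximal_normal[OF H M(1,3)] der M(2) by blast
  then have HK: "H \<inter> M = K"
    using irr K M unfolding irreducible_section_carrier_iff
    by (metis inf_le1 inf_le2 le_inf_iff subset_antisym)
  have sX: "subgroup (L \<inter> M) G" using sL sM by (rule subgroups_Inter_pair)
  have X_max_M: "maximal_subgroup (L \<inter> M) (G\<lparr>carrier := M\<rparr>)"
    unfolding maximal_subgroup_in_iff[OF sM]
  proof (intro conjI allI impI, goal_cases)
    case 1 show ?case by fact
  next
    case 2
    have "L \<noteq> M" using True M(3) by auto
    then have "\<not> M \<subseteq> L" using maximal_subgroup_subset_eq[OF M(1) L] by blast
    then show ?case by blast
  next
    case (3 J)
    then have J: "subgroup J G" "L \<inter> M \<subseteq> J" "J \<subseteq> M" by auto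
    have KJ: "K \<subseteq> J" using J K(2) True M(2) by blast
    have MHJ: "M \<inter> (H <#> J) = J"
      using dedekind_right[OF sH J(1) sM J(3)] HK KJ set_mult_subset[OF J(1) KJ order_refl]
        subset_set_mult(2)[OF normal_imp_subgroup[OF K(1)] J(1)] by (simp add: Int_commute)
    have "L = H <#> (L \<inter> M)"
      using dedekind_left[OF sH sM sL True] HM subgroup.subset[OF sL] by blast
    then have "L \<subseteq> H <#> J" using J(2) mono_set_mult by blast
    then have "H <#> J = L \<or> H <#> J = carrier G"
      using maximal_subgroupD(3)[OF L mult_norm_subgroup[OF H J(1)]] by simp
    then show ?case using MHJ subgroup.subset[OF sM] by auto
  qed
  have "weak_second_maximal (L \<inter> M) G"
    unfolding weak_second_maximal_def Max_over_def proper_subgroup_def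
    using X_max_M M(1) sX maximal_subgroupD(2)[OF M(1)] by blast
  then have "second_maximal (L \<inter> M) G" using wsm by (auto simp: WSM_group_def)
  then have "maximal_subgroup (L \<inter> M) (G\<lparr>carrier := L\<rparr>)"
    using L by (auto simp: second_maximal_def Max_over_def)
  then have X_max_L: "J = L \<inter> M \<or> J = L" if "subgroup J G" "L \<inter> M \<subseteq> J" "J \<subseteq> L" for J
    using maximal_subgroup_inD(3)[OF _ sL that] by simp
  show ?thesis
    unfolding irreducible_section_def
  proof (intro allI impI, elim conjE)
    fix W assume W: "subgroup W G" "K \<subseteq> W" "W \<subseteq> H"
      and inv: "\<forall>g\<in>L. \<forall>w\<in>W. g \<otimes> w \<otimes> inv g \<in> W"
    have WL: "W \<subseteq> L" using W True by blast
    have nW: "W \<lhd> G\<lparr>carrier := L\<rparr>"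
    proof (rule group.normal_invI[OF subgroup_imp_group[OF sL]])
      show "subgroup W (G\<lparr>carrier := L\<rparr>)" by (rule subgroup_incl[OF W(1) sL WL])
    qed (use inv sL in simp)
    have sJ: "subgroup (W <#> (L \<inter> M)) G"
      using mult_norm_sub_in_sub[OF nW subgroup_incl[OF sX sL] sL] incl_subgroup[OF sL] by auto
    have sub: "W \<subseteq> W <#> (L \<inter> M)" "L \<inter> M \<subseteq> W <#> (L \<inter> M)"
      using subset_set_mult[OF W(1) sX] by auto
    have "W <#> (L \<inter> M) \<subseteq> L" using WL by (intro set_mult_subset sL) auto
    then consider "W <#> (L \<inter> M) = L \<inter> M" | "W <#> (L \<inter> M) = L"
      using X_max_L[OF sJ sub(2)] by blast
    then show "W = K \<or> W = H"
    proof cases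
      case 1
      then have "W \<subseteq> H \<inter> M" using sub W by blast
      then show ?thesis using HK W by blast
    next
      case 2
      have "H = H \<inter> (W <#> (L \<inter> M))" using 2 True by blast
      also have "\<dots> = W <#> (H \<inter> (L \<inter> M))"
        using dedekind_left[OF W(1) sX sH W(3)] .
      also have "\<dots> \<subseteq> W"
        using HK W(2) by (intro set_mult_subset W) auto
      finally show ?thesis using W by blast
    qed
  qed
qed

text \<open>With \<open>K = D \<inter> M\<close>, the section \<open>D / K\<close> is abelian with complement \<open>M\<close>. If \<open>L\<close> does not contain
  \<open>K\<close>, then \<open>L\<close> maps onto \<open>G / K\<close> and \<open>M \<inter> L\<close> is the preimage in \<open>L\<close> of the maximal subgroup \<open>M / K\<close>. If \<open>L\<close> contains \<open>D\<close>,
  then \<open>L = D (M \<inter> L)\<close> and irreducibility under \<open>L\<close> applies. The remaining case is that both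
  subgroups complement \<open>D / K\<close>, and projection along \<open>D\<close> is an isomorphism from \<open>M / K\<close> to
  \<open>L / K\<close> fixing the image of \<open>M \<inter> L\<close>.\<close>

lemma maximal_Int_transfer:
  assumes M: "maximal_subgroup M G" and L: "maximal_subgroup L G" and ne: "L \<noteq> M"
    and D: "D \<lhd> G" "\<not> D \<subseteq> M" "derived G D \<subseteq> D \<inter> M"
    and irr: "irreducible_section G L D (D \<inter> M)"
    and X: "maximal_subgroup (M \<inter> L) (G\<lparr>carrier := M\<rparr>)"
  shows "maximal_subgroup (M \<inter> L) (G\<lparr>carrier := L\<rparr>)"
proof -
  define K where "K = D \<inter> M"
  interpret D: normal D G by fact
  have sM: "subgroup M G" and sL: "subgroup L G"
    using M L by (auto dest: maximal_subgroupD(1))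
  have sX: "subgroup (M \<inter> L) G" using sM sL by (rule subgroups_Inter_pair)
  have KG: "K \<lhd> G" using Int_maximal_normal[OF D(1) M D(2)] D(3) by (auto simp: K_def)
  then have sK: "subgroup K G" by (rule normal_imp_subgroup)
  have KM: "K \<subseteq> M" "K \<subseteq> D" by (auto simp: K_def)
  have DM: "D <#> M = carrier G" using maximal_subgroup_set_mult[OF M D(1,2)] .
  have "J = M \<inter> L \<or> J = L" if J: "subgroup J G" "M \<inter> L \<subseteq> J" "J \<subseteq> L" for J
  proof (cases "K \<subseteq> L")
    case False
    have "K <#> L = carrier G" using maximal_subgroup_set_mult[OF L KG False] .
    then have "M = K <#> (M \<inter> L)"
      using dedekind_left[OF sK sL sM KM(1)] subgroup.subset[OF sM] by blast
    then have "M \<subseteq> K <#> J" using J(2) mono_set_mult by blast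
    then consider "K <#> J = M" | "K <#> J = carrier G"
      using maximal_subgroupD(3)[OF M mult_norm_subgroup[OF KG J(1)]] by blast
    then show ?thesis
    proof cases
      case 1
      then show ?thesis using subset_set_mult(2)[OF sK J(1)] J by blast
    next
      case 2
      have "L = L \<inter> (K <#> J)" using 2 subgroup.subset[OF sL] by blast
      also have "\<dots> = (L \<inter> K) <#> J" using dedekind_right[OF sK J(1) sL J(3)] .
      also have "\<dots> \<subseteq> J" using J(2) KM by (intro set_mult_subset J(1)) auto
      finally show ?thesis using J by blast
    qed
  next
    case True
    have KJ: "K \<subseteq> J" using True KM J by blast
    have "D \<inter> L = K \<or> D \<inter> L = D"
      using irr unfolding K_def[symmetric]
    proof (rule irreducible_sectionD)
      show "subgroup (D \<inter> L) G" using D.subgroup_axioms sL by (rule subgroups_Inter_pair)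
      show "K \<subseteq> D \<inter> L" using True KM by blast
      show "g \<otimes> w \<otimes> inv g \<in> D \<inter> L" if "g \<in> L" "w \<in> D \<inter> L" for g w
        using that sL D.inv_op_closed2 subgroup.mem_carrier[OF sL]
        by (auto intro!: subgroup.m_closed subgroup.m_inv_closed)
    qed auto
    then consider "D \<inter> L = K" | "D \<subseteq> L" by blast
    then show ?thesis
    proof cases
      case 1
      have "M \<inter> L \<subseteq> M \<inter> (D <#> J)"
        using J subset_set_mult(2)[OF D.subgroup_axioms J(1)] by blast
      moreover have "subgroup (M \<inter> (D <#> J)) G"
        by (intro subgroups_Inter_pair sM mult_norm_subgroup D J)
      ultimately have "M \<inter> (D <#> J) = M \<inter> L \<or> M \<inter> (D <#> J) = M"
        by (intro maximal_subgroup_inD(3)[OF X sM]) auto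
      then show ?thesis
      proof
        assume eq: "M \<inter> (D <#> J) = M \<inter> L"
        have "subgroup (D <#> J) G" by (intro mult_norm_subgroup D J)
        then have "D <#> J = D <#> (M \<inter> L)"
          using dedekind_left[OF D.subgroup_axioms sM, of "D <#> J"] DM eq
            subset_set_mult(1)[OF D.subgroup_axioms J(1)] subgroup.subset[of "D <#> J" G]
          by (simp add: Int_commute Int_absorb1)
        then have "J \<subseteq> L \<inter> (D <#> (M \<inter> L))"
          using subset_set_mult(2)[OF D.subgroup_axioms J(1)] J by blast
        also have "\<dots> = K <#> (M \<inter> L)"
          using dedekind_right[OF D.subgroup_axioms sX sL] 1 by (simp add: Int_commute)
        also have "\<dots> \<subseteq> M \<inter> L" using True KM by (intro set_mult_subset sX) auto
        finally show ?thesis using J by blast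
      next
        assume "M \<inter> (D <#> J) = M"
        then have "D <#> M \<subseteq> D <#> J"
          using subset_set_mult(1)[OF D.subgroup_axioms J(1)]
          by (intro set_mult_subset mult_norm_subgroup D J) auto
        then have "L = L \<inter> (D <#> J)" using DM subgroup.subset[OF sL] by blast
        also have "\<dots> = K <#> J"
          using dedekind_right[OF D.subgroup_axioms J(1) sL J(3)] 1 by (simp add: Int_commute)
        also have "\<dots> \<subseteq> J" using KJ by (intro set_mult_subset J(1)) auto
        finally show ?thesis using J by blast
      qed
    next
      case 2
      have L_eq: "L = D <#> (M \<inter> L)"
        using dedekind_left[OF D.subgroup_axioms sM sL 2] DM subgroup.subset[OF sL]
        by (simp add: Int_commute Int_absorb2)
      have sDJ: "subgroup (D \<inter> J) G" using D.subgroup_axioms J(1) by (rule subgroups_Inter_pair)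
      \<comment> \<open>\<open>D\<close> normalises \<open>D \<inter> J\<close> because \<open>D / K\<close> is abelian, and \<open>M \<inter> L\<close> does because it lies
        in \<open>J\<close>.\<close>
      have "D \<inter> J = K \<or> D \<inter> J = D"
        using irr unfolding K_def[symmetric]
      proof (rule irreducible_sectionD)
        show "subgroup (D \<inter> J) G" by fact
        show "K \<subseteq> D \<inter> J" using KJ KM by blast
        fix g w assume "g \<in> L" and w: "w \<in> D \<inter> J"
        then have "g \<in> D <#> (M \<inter> L)" using L_eq by simp
        then obtain d m where dm: "d \<in> D" "m \<in> M \<inter> L" "g = d \<otimes> m"
          unfolding set_mult_def by blast
        have c: "d \<in> carrier G" "m \<in> carrier G" "w \<in> carrier G"
          using dm w sL by (auto simp: subgroup.mem_carrier)
        have "m \<in> J" using dm J by blast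
        then have y: "m \<otimes> w \<otimes> inv m \<in> D \<inter> J"
          using w c J(1) D.inv_op_closed2
          by (auto intro!: subgroup.m_closed subgroup.m_inv_closed)
        have "d \<otimes> (m \<otimes> w \<otimes> inv m) \<otimes> inv d \<in> D \<inter> J"
          by (rule conj_mem_of_derived_subset[OF sDJ _ D.subset dm(1) _ y])
            (use D(3) y KJ KM in \<open>auto simp: K_def\<close>)
        then show "g \<otimes> w \<otimes> inv g \<in> D \<inter> J" using conj_set_mult[OF c] dm(3) by simp
      qed auto
      then show ?thesis
      proof
        assume eq: "D \<inter> J = K"
        have "J = J \<inter> (D <#> (M \<inter> L))" using L_eq J by blast
        also have "\<dots> = K <#> (M \<inter> L)"
          using dedekind_right[OF D.subgroup_axioms sX J(1,2)] eq by (simp add: Int_commute)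
        also have "\<dots> \<subseteq> M \<inter> L" using True KM by (intro set_mult_subset sX) auto
        finally show ?thesis using J by blast
      next
        assume "D \<inter> J = D"
        then have "D <#> (M \<inter> L) \<subseteq> J" using J by (intro set_mult_subset) auto
        then show ?thesis using L_eq J by blast
      qed
    qed
  qed
  moreover have "M \<inter> L \<subset> L" using maximal_subgroup_subset_eq[OF L M] ne by blast
  ultimately show ?thesis using sX unfolding maximal_subgroup_in_iff[OF sL] by simp
qed

end


section \<open>Subgroups of a quotient\<close>

context normal
begin

lemma r_coset_group_hom: "group_hom G (G Mod H) (\<lambda>g. H #> g)"
  by (intro group_hom.intro group_hom_axioms.intro is_group factorgroup_is_group r_coset_hom_Mod)

lemma subgroup_image_r_coset:
  assumes "subgroup R G"
  shows "subgroup ((\<lambda>g. H #> g) ` R) (G Mod H)"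
  using group_hom.subgroup_img_is_subgroup[OF r_coset_group_hom assms] .

lemma image_r_coset_subset_iff:
  assumes "subgroup S G" "H \<subseteq> S" "R \<subseteq> carrier G"
  shows "(\<lambda>g. H #> g) ` R \<subseteq> (\<lambda>g. H #> g) ` S \<longleftrightarrow> R \<subseteq> S"
proof
  assume sub: "(\<lambda>g. H #> g) ` R \<subseteq> (\<lambda>g. H #> g) ` S"
  show "R \<subseteq> S"
  proof
    fix r assume r: "r \<in> R"
    then obtain s where s: "s \<in> S" "H #> r = H #> s" using sub by blast
    have "r \<in> H #> s" using rcos_self[of r] r assms(3) subgroup_axioms s(2) by auto
    then show "r \<in> S"
      using assms s by (auto simp: r_coset_def subset_iff subgroup.m_closed)
  qed
qed auto

lemma image_r_coset_eq_iff:
  assumes "subgroup S G" "H \<subseteq> S" "subgroup R G" "H \<subseteq> R"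
  shows "(\<lambda>g. H #> g) ` R = (\<lambda>g. H #> g) ` S \<longleftrightarrow> R = S"
  using image_r_coset_subset_iff[OF assms(1,2) subgroup.subset[OF assms(3)]]
    image_r_coset_subset_iff[OF assms(3,4) subgroup.subset[OF assms(1)]] by blast

lemma image_r_coset_self: "(\<lambda>g. H #> g) ` H = {H}"
proof -
  have "(\<lambda>g. H #> g) ` H = (\<lambda>g. H) ` H"
    by (intro image_cong refl rcos_const is_group)
  also have "\<dots> = {H}" by (rule image_constant[OF subgroup.one_closed[OF subgroup_axioms]])
  finally show ?thesis .
qed

lemma subgroup_Mod_eq_image:
  assumes "subgroup A (G Mod H)"
  shows "H \<subseteq> \<Union>A" "A = (\<lambda>g. H #> g) ` \<Union>A"
proof -
  have "H \<in> A" using subgroup.one_closed[OF assms] by simp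
  then show "H \<subseteq> \<Union>A" by blast
  have "A \<subseteq> (\<lambda>g. H #> g) ` carrier G"
    using subgroup.subset[OF assms] by (simp add: carrier_FactGroup)
  then show "A = (\<lambda>g. H #> g) ` \<Union>A"
    unfolding factgroup_subgroup_union_char[OF assms] by blast
qed

lemma maximal_subgroup_Mod_iff:
  assumes M: "subgroup M G" "H \<subseteq> M"
  shows "maximal_subgroup ((\<lambda>g. H #> g) ` M) (G Mod H) \<longleftrightarrow> maximal_subgroup M G"
    (is "maximal_subgroup (?\<pi> M) ?Q \<longleftrightarrow> _")
proof -
  interpret Q: group ?Q by (rule factorgroup_is_group)
  have carr: "carrier ?Q = ?\<pi> (carrier G)" by (simp add: carrier_FactGroup)
  have eq: "?\<pi> R = ?\<pi> S \<longleftrightarrow> R = S" if "subgroup R G" "H \<subseteq> R" "subgroup S G" "H \<subseteq> S" for R S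
    using image_r_coset_eq_iff[OF that(3,4,1,2)] .
  have sub: "?\<pi> M \<subseteq> ?\<pi> S \<longleftrightarrow> M \<subseteq> S" if "subgroup S G" "H \<subseteq> S" for S
    using image_r_coset_subset_iff[OF that subgroup.subset[OF M(1)]] .
  have "(\<forall>J. subgroup J ?Q \<and> ?\<pi> M \<subseteq> J \<longrightarrow> J = ?\<pi> M \<or> J = carrier ?Q) \<longleftrightarrow>
      (\<forall>J. subgroup J G \<and> M \<subseteq> J \<longrightarrow> J = M \<or> J = carrier G)" (is "?l = ?r")
  proof
    assume l: ?l
    show ?r
    proof (intro allI impI, elim conjE)
      fix J assume J: "subgroup J G" "M \<subseteq> J"
      then have "?\<pi> J = ?\<pi> M \<or> ?\<pi> J = carrier ?Q"
        by (intro l[rule_format] conjI subgroup_image_r_coset image_mono)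
      then show "J = M \<or> J = carrier G"
        using eq[OF J(1) _ M] eq[OF J(1) _ subgroup_self subset] J(2) M(2) unfolding carr by blast
    qed
  next
    assume r: ?r
    show ?l
    proof (intro allI impI, elim conjE)
      fix J assume J: "subgroup J ?Q" "?\<pi> M \<subseteq> J"
      have "subgroup (\<Union>J) G" using factgroup_subgroup_union_subgroup[OF J(1)] .
      moreover have "M \<subseteq> \<Union>J"
        using sub[OF calculation subgroup_Mod_eq_image(1)[OF J(1)]] J(2)
        unfolding subgroup_Mod_eq_image(2)[OF J(1), symmetric] by (rule iffD1)
      ultimately have "\<Union>J = M \<or> \<Union>J = carrier G" by (intro r[rule_format] conjI)
      then show "J = ?\<pi> M \<or> J = carrier ?Q"
        using subgroup_Mod_eq_image(2)[OF J(1)] carr by metis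
    qed
  qed
  moreover have "?\<pi> M \<subset> carrier ?Q \<longleftrightarrow> M \<subset> carrier G"
    using eq[OF M subgroup_self subset] carr subgroup.subset[OF M(1)] by auto
  ultimately show ?thesis
    unfolding Q.maximal_subgroup_iff maximal_subgroup_iff
    using subgroup_image_r_coset[OF M(1)] M(1) by simp
qed

end


section \<open>Chief factors as sections\<close>

context group
begin

lemma chief_factor_iff:
  "chief_factor G H K \<longleftrightarrow>
    H \<lhd> G \<and> K \<lhd> G \<and> K \<subset> H \<and> irreducible_section G (carrier G) H K"
proof -
  have "minimal_normal (carrier (factor G H K)) (G Mod K) \<longleftrightarrow>
      irreducible_section G (carrier G) H K"
    if HK: "H \<lhd> G" "K \<lhd> G" "K \<subset> H"
  proof -
    interpret K: normal K G by fact
    let ?\<pi> = "\<lambda>R. (\<lambda>g. K #> g) ` R"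
    have sH: "subgroup H G" using HK(1) by (rule normal_imp_subgroup)
    have img: "?\<pi> R \<lhd> G Mod K" if "R \<lhd> G" for R
      using normal.surj_hom_normal_subgroup[OF that K.r_coset_group_hom]
      by (simp add: carrier_FactGroup)
    have KH: "K \<subseteq> H" "H \<noteq> K" using HK(3) by auto
    have "?\<pi> H \<noteq> {K}"
      using K.image_r_coset_eq_iff[OF K.subgroup_axioms order_refl sH KH(1)] KH(2)
      unfolding K.image_r_coset_self by simp
    moreover have "(\<forall>A. A \<lhd> G Mod K \<and> A \<subseteq> ?\<pi> H \<longrightarrow> A = {K} \<or> A = ?\<pi> H) \<longleftrightarrow>
        (\<forall>R. R \<lhd> G \<and> K \<subseteq> R \<and> R \<subseteq> H \<longrightarrow> R = K \<or> R = H)" (is "?l = ?r")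
    proof
      assume l: ?l
      show ?r
      proof (intro allI impI, elim conjE)
        fix R assume R: "R \<lhd> G" "K \<subseteq> R" "R \<subseteq> H"
        then have "?\<pi> R = {K} \<or> ?\<pi> R = ?\<pi> H"
          by (intro l[rule_format] conjI img image_mono)
        then have "?\<pi> R = ?\<pi> K \<or> ?\<pi> R = ?\<pi> H" unfolding K.image_r_coset_self .
        then show "R = K \<or> R = H"
          using K.image_r_coset_eq_iff[OF K.subgroup_axioms order_refl normal_imp_subgroup[OF R(1)]]
            K.image_r_coset_eq_iff[OF sH KH(1) normal_imp_subgroup[OF R(1)]] R(2) by simp
      qed
    next
      assume r: ?r
      show ?l
      proof (intro allI impI, elim conjE)
        fix A assume A: "A \<lhd> G Mod K" "A \<subseteq> ?\<pi> H"
        note sA = normal_imp_subgroup[OF A(1)]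
        note A_eq = K.subgroup_Mod_eq_image[OF sA]
        have "\<Union>A \<lhd> G" using K.factgroup_subgroup_union_normal[OF A(1)] .
        moreover have "\<Union>A \<subseteq> H"
          using K.image_r_coset_subset_iff[OF sH KH(1)
              subgroup.subset[OF normal_imp_subgroup[OF calculation]]] A(2) unfolding A_eq(2)[symmetric] by simp
        ultimately have "\<Union>A = K \<or> \<Union>A = H"
          using A_eq(1) by (intro r[rule_format] conjI)
        then show "A = {K} \<or> A = ?\<pi> H" 
          unfolding K.image_r_coset_self[symmetric] by (subst (1 2) A_eq(2)) (elim disjE; simp)
      qed
    qed
    ultimately show ?thesis
      unfolding minimal_normal_def carrier_factor irreducible_section_carrier_iff
      using img[OF HK(1)] by simp
  qed
  then show ?thesis unfolding chief_factor_def by blast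
qed

lemma non_frattini_chief_factor_iff:
  "non_frattini_chief_factor G H K \<longleftrightarrow>
    chief_factor G H K \<and> (\<exists>M. maximal_subgroup M G \<and> K \<subseteq> M \<and> \<not> H \<subseteq> M)"
proof -
  have "\<not> carrier (factor G H K) \<subseteq> frattini (G Mod K) \<longleftrightarrow>
      (\<exists>M. maximal_subgroup M G \<and> K \<subseteq> M \<and> \<not> H \<subseteq> M)"
    if HK: "H \<lhd> G" "K \<lhd> G"
  proof -
    interpret K: normal K G by fact
    interpret Q: group "G Mod K" by (rule K.factorgroup_is_group)
    let ?\<pi> = "\<lambda>R. (\<lambda>g. K #> g) ` R"
    have Hc: "H \<subseteq> carrier G" using HK(1) by (simp add: normal_imp_subgroup subgroup.subset)
    then have "?\<pi> H \<subseteq> ?\<pi> (carrier G)" by (rule image_mono)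
    then have "\<not> carrier (factor G H K) \<subseteq> frattini (G Mod K) \<longleftrightarrow>
        (\<exists>A. maximal_subgroup A (G Mod K) \<and> \<not> ?\<pi> H \<subseteq> A)"
      unfolding carrier_factor frattini_def carrier_FactGroup by blast
    also have "\<dots> \<longleftrightarrow> (\<exists>M. maximal_subgroup M G \<and> K \<subseteq> M \<and> \<not> H \<subseteq> M)" (is "?l = ?r")
    proof
      assume ?l
      then obtain A where A: "maximal_subgroup A (G Mod K)" "\<not> ?\<pi> H \<subseteq> A" by blast
      then have sA: "subgroup A (G Mod K)" by (intro Q.maximal_subgroupD)
      note A_eq = K.subgroup_Mod_eq_image[OF sA]
      have "maximal_subgroup (\<Union>A) G"
        using K.maximal_subgroup_Mod_iff[OF K.factgroup_subgroup_union_subgroup[OF sA] A_eq(1)]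
          A(1) unfolding A_eq(2)[symmetric] by blast
      moreover have "\<not> H \<subseteq> \<Union>A"
      proof
        assume "H \<subseteq> \<Union>A"
        then have "?\<pi> H \<subseteq> ?\<pi> (\<Union>A)" by (rule image_mono)
        then show False using A(2) unfolding A_eq(2)[symmetric] by simp
      qed
      ultimately show ?r using A_eq(1) by (intro exI conjI)
    next
      assume ?r
      then obtain M where M: "maximal_subgroup M G" "K \<subseteq> M" "\<not> H \<subseteq> M" by blast
      then have sM: "subgroup M G" by (intro maximal_subgroupD)
      have "maximal_subgroup (?\<pi> M) (G Mod K)" "\<not> ?\<pi> H \<subseteq> ?\<pi> M"
        using K.maximal_subgroup_Mod_iff[OF sM M(2)] K.image_r_coset_subset_iff[OF sM M(2) Hc] M
        by simp_all
      then show ?l by (intro exI conjI)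
    qed
    finally show ?thesis .
  qed
  then show ?thesis unfolding non_frattini_chief_factor_def chief_factor_def by blast
qed

lemma factor_comm_groupI:
  assumes H: "H \<lhd> G" and K: "K \<lhd> G" "K \<subseteq> H"
    and der: "derived G H \<subseteq> K"
  shows "comm_group (factor G H K)"
proof -
  interpret H: normal H G by fact
  interpret K: normal K G by fact
  have "K \<lhd> G\<lparr>carrier := H\<rparr>"
    using normal_restrict_supergroup[OF H.subgroup_axioms K] .
  then have grp: "group (factor G H K)"
    unfolding factor_def by (rule normal.factorgroup_is_group)
  show ?thesis
  proof (rule group.group_comm_groupI[OF grp])
    fix X Y assume "X \<in> carrier (factor G H K)" "Y \<in> carrier (factor G H K)"
    then obtain x y where xy: "x \<in> H" "y \<in> H" "X = K #> x" "Y = K #> y"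
      by (auto simp: carrier_factor)
    have c: "x \<in> carrier G" "y \<in> carrier G" using xy by auto
    have "x \<otimes> y \<otimes> inv x \<otimes> inv y \<in> K"
      using der xy unfolding derived_def by (auto intro: generate.incl)
    then have "x \<otimes> y \<otimes> inv (y \<otimes> x) \<in> K" using c by (simp add: inv_mult_group m_assoc)
    then have "x \<otimes> y \<in> K #> (y \<otimes> x)" using c by (simp add: K.rcos_module[OF is_group])
    then have "K #> (y \<otimes> x) = K #> (x \<otimes> y)"
      using c K.subgroup_axioms by (intro repr_independence) auto
    then show "X \<otimes>\<^bsub>factor G H K\<^esub> Y = Y \<otimes>\<^bsub>factor G H K\<^esub> X"
      using xy c by (simp add: mult_factor K.rcos_sum)
  qed
qed

text \<open>If \<open>D \<le> H\<close> is a normal subgroup of smallest order not contained in \<open>K\<close>, then \<open>H = K D\<close> because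
  \<open>H / K\<close> is a chief factor, and the derived subgroup of \<open>D\<close> lies in \<open>K\<close>. So \<open>H / K\<close> is an image
  of an abelian group.\<close>

lemma chief_factor_derived_subset:
  assumes fin: "finite (carrier G)" and solv: "solvable G" and HK: "chief_factor G H K"
  shows "derived G H \<subseteq> K"
proof -
  have H: "H \<lhd> G" and K: "K \<lhd> G" "K \<subset> H"
    and irr: "\<And>R. R \<lhd> G \<Longrightarrow> K \<subseteq> R \<Longrightarrow> R \<subseteq> H \<Longrightarrow> R = K \<or> R = H"
    using HK unfolding chief_factor_iff irreducible_section_carrier_iff by (metis, metis, metis, metis)
  interpret H: normal H G by fact
  interpret K: normal K G by fact
  obtain D where D: "D \<lhd> G" "D \<subseteq> H" "\<not> D \<subseteq> K" "derived G D \<subseteq> K"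
    using exists_normal_minimal_not_subset[OF fin solv H K.subgroup_axioms] K(2)
    by (metis psubset_eq subset_antisym)
  interpret D: normal D G by fact
  interpret Q: group_hom G "G Mod K" "\<lambda>g. K #> g" by (rule K.r_coset_group_hom)
  have "K <#> D \<lhd> G"
  proof (rule normal_invI)
    show "subgroup (K <#> D) G" by (rule mult_norm_subgroup[OF K(1) D.subgroup_axioms])
    fix g x assume g: "g \<in> carrier G" and "x \<in> K <#> D"
    then obtain k d where kd: "k \<in> K" "d \<in> D" "x = k \<otimes> d" by (auto simp: set_mult_def)
    have "g \<otimes> x \<otimes> inv g = (g \<otimes> k \<otimes> inv g) \<otimes> (g \<otimes> d \<otimes> inv g)"
      using g kd by (simp add: m_assoc inv_solve_left)
    moreover have "g \<otimes> k \<otimes> inv g \<in> K" "g \<otimes> d \<otimes> inv g \<in> D"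
      using g kd K.inv_op_closed2 D.inv_op_closed2 by auto
    ultimately show "g \<otimes> x \<otimes> inv g \<in> K <#> D" unfolding set_mult_def by blast
  qed
  moreover have "K \<subseteq> K <#> D" "D \<subseteq> K <#> D"
    using subset_set_mult[OF K.subgroup_axioms D.subgroup_axioms] by auto
  moreover have "K <#> D \<subseteq> H" using K D by (intro set_mult_subset H.subgroup_axioms) auto
  ultimately have "K <#> D = K \<or> K <#> D = H" by (intro irr)
  then have KD: "K <#> D = H" using D(3) \<open>D \<subseteq> K <#> D\<close> by auto
  have img: "(\<lambda>g. K #> g) ` H = (\<lambda>g. K #> g) ` D"
  proof
    show "(\<lambda>g. K #> g) ` H \<subseteq> (\<lambda>g. K #> g) ` D"
    proof
      fix X assume "X \<in> (\<lambda>g. K #> g) ` H"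
      then obtain k d where kd: "k \<in> K" "d \<in> D" "X = K #> (k \<otimes> d)"
        using KD by (auto simp: set_mult_def)
      then have "X = K #> d"
        using coset_mult_assoc[OF K.subset, of k d] K.rcos_const[OF is_group, of k] by simp
      then show "X \<in> (\<lambda>g. K #> g) ` D" using kd by blast
    qed
  qed (use D(2) in auto)
  have "(\<lambda>g. K #> g) ` derived G H = derived (G Mod K) ((\<lambda>g. K #> g) ` H)"
    using Q.derived_img[OF H.subset] by simp
  also have "\<dots> = (\<lambda>g. K #> g) ` derived G D"
    using Q.derived_img[OF D.subset] img by simp
  also have "\<dots> \<subseteq> (\<lambda>g. K #> g) ` K" using D(4) by blast
  finally show ?thesis
    using K.image_r_coset_subset_iff[OF K.subgroup_axioms order_refl derived_in_carrier[OF H.subset]]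
    by (rule iffD1[rotated])
qed


section \<open>Factors as modules\<close>

lemma gmodule_restrict:
  assumes g: "gmodule G V \<phi>" and L: "subgroup L G"
  shows "gmodule (G\<lparr>carrier := L\<rparr>) V \<phi>"
proof -
  have h: "\<phi> \<in> hom G (AutoGroup V)" using gmodule.action_hom[OF g] .
  have c: "comm_group V" using g unfolding gmodule_def by blast
  have "\<phi> \<in> hom (G\<lparr>carrier := L\<rparr>) (AutoGroup V)"
  proof (rule homI)
    fix x y assume "x \<in> carrier (G\<lparr>carrier := L\<rparr>)" "y \<in> carrier (G\<lparr>carrier := L\<rparr>)"
    then have "x \<in> carrier G" "y \<in> carrier G" using subgroup.mem_carrier[OF L] by simp_all
    then show "\<phi> x \<in> carrier (AutoGroup V)"
        "\<phi> (x \<otimes>\<^bsub>G\<lparr>carrier := L\<rparr>\<^esub> y) = \<phi> x \<otimes>\<^bsub>AutoGroup V\<^esub> \<phi> y"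
      using hom_in_carrier[OF h] hom_mult[OF h] by simp_all
  qed
  then show ?thesis
    by (intro gmodule.intro gmodule_axioms.intro subgroup_imp_group L c)
qed

text \<open>The submodules of \<open>H / K\<close> correspond to the invariant subgroups between \<open>K\<close> and \<open>H\<close>; the
  derived subgroup condition makes \<open>H / K\<close> abelian, as a module has to be.\<close>

lemma irreducible_gmodule_factor_iff:
  assumes H: "H \<lhd> G" and K: "K \<lhd> G" "K \<subset> H" and der: "derived G H \<subseteq> K"
    and L: "subgroup L G"
  shows "irreducible_gmodule (G\<lparr>carrier := L\<rparr>) (factor G H K) (conj_action G H K) \<longleftrightarrow>
    irreducible_section G L H K"
proof -
  interpret H: normal H G by fact
  let ?V = "factor G H K"
  have KH: "K \<lhd> G\<lparr>carrier := H\<rparr>"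
    using normal_restrict_supergroup[OF H.subgroup_axioms K(1)] K(2) by blast
  interpret K: normal K G by fact
  interpret K': normal K "G\<lparr>carrier := H\<rparr>" by (rule KH)
  let ?\<pi> = "\<lambda>R. (\<lambda>g. K #> g) ` R"
  have V: "?V = (G\<lparr>carrier := H\<rparr>) Mod K" by (simp add: factor_def)
  have carr: "carrier ?V = ?\<pi> H" by (rule carrier_factor)
  have one: "\<one>\<^bsub>?V\<^esub> = K" by (simp add: V)
  have gmod: "gmodule (G\<lparr>carrier := L\<rparr>) ?V (conj_action G H K)"
    using K by (intro gmodule_restrict gmodule_conj_action factor_comm_groupI H der L) auto
  have eq: "?\<pi> R = ?\<pi> S \<longleftrightarrow> R = S" if "subgroup R G" "K \<subseteq> R" "subgroup S G" "K \<subseteq> S" for R S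
    using K.image_r_coset_eq_iff[OF that(3,4,1,2)] .
  have nontriv: "?\<pi> H \<noteq> {K}"
    using eq[OF H.subgroup_axioms _ K.subgroup_axioms] K unfolding K.image_r_coset_self by simp
  have conj: "(\<forall>g\<in>L. conj_action G H K g ` ?\<pi> W \<subseteq> ?\<pi> W) \<longleftrightarrow> (\<forall>g\<in>L. \<forall>w\<in>W. g \<otimes> w \<otimes> inv g \<in> W)"
    if W: "subgroup W G" "K \<subseteq> W" "W \<subseteq> H" for W
  proof (intro ball_cong refl)
    fix g assume g: "g \<in> L"
    then have gc: "g \<in> carrier G" using L by (simp add: subgroup.mem_carrier)
    have "conj_action G H K g ` ?\<pi> W = ?\<pi> ((\<lambda>w. g \<otimes> w \<otimes> inv g) ` W)"
      unfolding image_image using W(3) conj_action_rcos[OF H K(1) gc] by (intro image_cong) auto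
    moreover have "(\<lambda>w. g \<otimes> w \<otimes> inv g) ` W \<subseteq> carrier G"
      using gc W(1) by (auto simp: subgroup.mem_carrier)
    ultimately have "conj_action G H K g ` ?\<pi> W \<subseteq> ?\<pi> W \<longleftrightarrow> (\<lambda>w. g \<otimes> w \<otimes> inv g) ` W \<subseteq> W"
      using K.image_r_coset_subset_iff[OF W(1,2)] by presburger
    then show "(conj_action G H K g ` ?\<pi> W \<subseteq> ?\<pi> W) = (\<forall>w\<in>W. g \<otimes> w \<otimes> inv g \<in> W)"
      unfolding image_subset_iff[of _ W W] .
  qed
  have "(\<forall>A. submodule A (G\<lparr>carrier := L\<rparr>) ?V (conj_action G H K) \<longrightarrow> A = {K} \<or> A = ?\<pi> H) \<longleftrightarrow>
    irreducible_section G L H K" (is "?l = ?r")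
  proof
    assume l: ?l
    show ?r
      unfolding irreducible_section_def
    proof (intro allI impI, elim conjE)
      fix W assume W: "subgroup W G" "K \<subseteq> W" "W \<subseteq> H"
        and inv: "\<forall>g\<in>L. \<forall>w\<in>W. g \<otimes> w \<otimes> inv g \<in> W"
      have "subgroup (?\<pi> W) ?V"
        using K'.subgroup_image_r_coset[OF subgroup_incl[OF W(1) H.subgroup_axioms W(3)]]
        by (simp add: V)
      then have "submodule (?\<pi> W) (G\<lparr>carrier := L\<rparr>) ?V (conj_action G H K)"
        using conj[OF W] inv by (simp add: submodule_def)
      then have "?\<pi> W = {K} \<or> ?\<pi> W = ?\<pi> H" by (rule l[rule_format])
      then have "?\<pi> W = ?\<pi> K \<or> ?\<pi> W = ?\<pi> H" unfolding K.image_r_coset_self .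
      then show "W = K \<or> W = H"
        using eq[OF W(1,2) K.subgroup_axioms] eq[OF W(1,2) H.subgroup_axioms] K(2) by simp
    qed
  next
    assume r: ?r
    show ?l
    proof (intro allI impI)
      fix A assume "submodule A (G\<lparr>carrier := L\<rparr>) ?V (conj_action G H K)"
      then have A: "subgroup A ((G\<lparr>carrier := H\<rparr>) Mod K)"
        and inv: "\<forall>g\<in>L. conj_action G H K g ` A \<subseteq> A"
        by (auto simp: submodule_def V)
      have A_eq: "K \<subseteq> \<Union>A" "A = ?\<pi> (\<Union>A)"
        using K'.subgroup_Mod_eq_image[OF A] by simp_all
      have sub: "subgroup (\<Union>A) (G\<lparr>carrier := H\<rparr>)"
        using K'.factgroup_subgroup_union_subgroup[OF A] .
      have W: "subgroup (\<Union>A) G" "\<Union>A \<subseteq> H"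
        using incl_subgroup[OF H.subgroup_axioms sub] subgroup.subset[OF sub] by simp_all
      have "\<forall>g\<in>L. \<forall>w\<in>\<Union>A. g \<otimes> w \<otimes> inv g \<in> \<Union>A"
        using conj[OF W(1) A_eq(1) W(2)] inv A_eq(2) by metis
      then have "\<Union>A = K \<or> \<Union>A = H"
        using irreducible_sectionD[OF r W(1) A_eq(1) W(2)] by blast
      then show "A = {K} \<or> A = ?\<pi> H" 
          unfolding K.image_r_coset_self[symmetric] by (subst (1 2) A_eq(2)) (elim disjE; simp)
    qed
  qed
  then show ?thesis
    unfolding irreducible_gmodule_def carr one using gmod nontriv by blast
qed

lemma strongly_irreducible_factor_iff:
  assumes HK: "chief_factor G H K" and der: "derived G H \<subseteq> K"
  shows "strongly_irreducible G (factor G H K) (conj_action G H K) \<longleftrightarrow>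
    (\<forall>L. maximal_subgroup L G \<longrightarrow> irreducible_section G L H K)"
proof -
  have H: "H \<lhd> G" and K: "K \<lhd> G" "K \<subset> H" and irr: "irreducible_section G (carrier G) H K"
    using HK by (auto simp: chief_factor_iff)
  note iff = irreducible_gmodule_factor_iff[OF H K der]
  have "irreducible_gmodule G (factor G H K) (conj_action G H K)"
    using iff[OF subgroup_self] irr by simp
  moreover have "carrier G \<noteq> {\<one>}"
  proof
    assume "carrier G = {\<one>}"
    moreover have "H \<subseteq> carrier G" "\<one> \<in> K"
      using normal_imp_subgroup[OF H] normal_imp_subgroup[OF K(1)]
      by (auto simp: subgroup.subset subgroup.one_closed dest: subgroup.mem_carrier)
    ultimately show False using K(2) by auto
  qed
  ultimately show ?thesis
    unfolding strongly_irreducible_def using iff[OF maximal_subgroupD(1)] by auto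
qed

end


section \<open>WSM-groups and strongly irreducible chief factors\<close>

theorem theoremC:
  fixes G :: "('a, 'b) monoid_scheme"
  assumes "group G" and "finite (carrier G)" and "solvable G"
  shows "WSM_group G \<longleftrightarrow>
    (\<forall>H K. non_frattini_chief_factor G H K \<longrightarrow>
      strongly_irreducible G (factor G H K) (conj_action G H K))"
proof -
  interpret group G by fact
  have strong_iff: "strongly_irreducible G (factor G H K) (conj_action G H K) \<longleftrightarrow>
      (\<forall>L. maximal_subgroup L G \<longrightarrow> irreducible_section G L H K)" if "chief_factor G H K" for H K
    using strongly_irreducible_factor_iff[OF that chief_factor_derived_subset[OF assms(2,3) that]] .
  show ?thesis
  proof
    assume wsm: "WSM_group G"
    show "\<forall>H K. non_frattini_chief_factor G H K \<longrightarrow>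
        strongly_irreducible G (factor G H K) (conj_action G H K)"
    proof (intro allI impI)
      fix H K assume "non_frattini_chief_factor G H K"
      then obtain M where HK: "chief_factor G H K"
        and M: "maximal_subgroup M G" "K \<subseteq> M" "\<not> H \<subseteq> M"
        by (auto simp: non_frattini_chief_factor_iff)
      have "H \<lhd> G" "K \<lhd> G" "K \<subseteq> H" "irreducible_section G (carrier G) H K"
        using HK unfolding chief_factor_iff by auto
      then have "irreducible_section G L H K" if "maximal_subgroup L G" for L
        using WSM_imp_irreducible_section[OF wsm _ _ _ _ _ M that]
          chief_factor_derived_subset[OF assms(2,3) HK] by simp
      then show "strongly_irreducible G (factor G H K) (conj_action G H K)"
        by (simp add: strong_iff[OF HK])
    qed
  next
    assume strong: "\<forall>H K. non_frattini_chief_factor G H K \<longrightarrow>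
        strongly_irreducible G (factor G H K) (conj_action G H K)"
    have transfer: "maximal_subgroup X (G\<lparr>carrier := L\<rparr>)"
      if M: "maximal_subgroup M G" and X: "maximal_subgroup X (G\<lparr>carrier := M\<rparr>)"
        and L: "maximal_subgroup L G" "X \<subseteq> L" for X M L
    proof (cases "L = M")
      case False
      have sM: "subgroup M G" "\<not> carrier G \<subseteq> M" and sL: "subgroup L G"
        using maximal_subgroupD(1,2)[OF M] maximal_subgroupD(1)[OF L(1)] by auto
      have "X \<subseteq> M \<inter> L" "M \<inter> L \<subset> M"
        using maximal_subgroup_inD(2)[OF X sM(1)] L(2)
          maximal_subgroup_subset_eq[OF M L(1)] False by auto
      then have X_eq: "X = M \<inter> L"
        using maximal_subgroup_inD(3)[OF X sM(1) subgroups_Inter_pair[OF sM(1) sL]] by blast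
      obtain D where D: "D \<lhd> G" "D \<subseteq> carrier G" "\<not> D \<subseteq> M" "derived G D \<subseteq> M"
        and small: "\<forall>R. R \<lhd> G \<and> R \<subset> D \<longrightarrow> R \<subseteq> M"
        by (rule exists_normal_minimal_not_subset[OF assms(2,3) normal_self sM])
          blast
      have der: "derived G D \<subseteq> D \<inter> M"
        using D(4) derived_incl[OF order_refl normal_imp_subgroup[OF D(1)]] by simp
      have "R = D \<inter> M \<or> R = D" if "R \<lhd> G" "D \<inter> M \<subseteq> R" "R \<subseteq> D" for R
        using small that by blast
      moreover have "D \<inter> M \<lhd> G" using Int_maximal_normal[OF D(1) M D(3,4)] .
      ultimately have chief: "chief_factor G D (D \<inter> M)"
        unfolding chief_factor_iff irreducible_section_carrier_iff using D(1,3) by auto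
      then have "non_frattini_chief_factor G D (D \<inter> M)"
        unfolding non_frattini_chief_factor_iff using M D(3) by auto
      then have "irreducible_section G L D (D \<inter> M)"
        using strong strong_iff[OF chief] L(1) by simp
      then show ?thesis
        using maximal_Int_transfer[OF M L(1) False D(1,3) der] X unfolding X_eq by simp
    qed (use X in simp)
    show "WSM_group G"
      unfolding WSM_group_def second_maximal_def weak_second_maximal_def Max_over_def
      using is_group by (auto intro: transfer)
  qed
qed

end
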